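(* Let $k=\mathbb{F}_q$ be a finite field of odd characteristic. Let $n$ be an even positive integer, let $S$ be a rational $n$-set of $\mathbb{P}^1$, and let $\gamma\in\operatorname{PGL}_2(k)$ satisfy $\gamma(S)=S$. Let $m$ be the order of $\gamma$ in $\operatorname{PGL}_2(k)$ and let $\operatorname{Fix}_\gamma$ be the set of fixed points of $\gamma$ in $\mathbb{P}^1(\overline{k})$. Then $$\epsilon(\gamma,S)=\begin{cases} (-1)^{(q-1)/m}, & \text{if } \gamma(t)=\lambda t \text{ with } \lambda\in k^*, \text{ and } \infty\in S,\\ 1, & \text{if } \gamma(t)=\lambda t \text{ with } \lambda\in k^*, \text{ and } \infty\notin S,\\ 1, & \text{if } \gamma(t)=t+1,\\ (-1)^{(q+1)/m}(-1)^{(n-2)/m}, & \text{if } \gamma \text{ is potentially homothetic and } \operatorname{Fix}_\gamma\subseteq S,\\ (-1)^{n/m}, & \text{if } \gamma \text{ is potentially homothetic and } \operatorname{Fix}_\gamma\not\subseteq S. \end{cases}$$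
   Context: $\overline{k}$ is an algebraic closure of $k$, and $k_2\subset\overline{k}$ is the quadratic extension of $k$. A rational $n$-set of $\mathbb{P}^1$ is a set $S$ of $n$ distinct points of $\mathbb{P}^1(\overline{k})$ that is stable under $\operatorname{Gal}(\overline{k}/k)$. A matrix $\gamma=\begin{pmatrix}a&b\\c&d\end{pmatrix}\in\operatorname{GL}_2(k)$ acts on $\mathbb{P}^1(\overline{k})$ by $t\mapsto (at+b)/(ct+d)$; $\operatorname{PGL}_2(k)$ acts accordingly. For $\gamma=\begin{pmatrix}a&b\\c&d\end{pmatrix}\in\operatorname{GL}_2(k)$ and $t\in\mathbb{P}^1(\overline{k})$ define the local multiplier $$j(\gamma,t)=\begin{cases}\det(\gamma)(ct+d)^{-1}&\text{if }t\ne\infty,\ ct+d\neq0,\\ c&\text{if }c\ne0,\ t=-d/c,\\ d&\text{if }t=\infty,\ c=0,\\ -\det(\gamma)c^{-1}&\text{if }t=\infty,\ c\ne0,\end{cases}$$ and for a rational $n$-set $S$ put $J(\gamma,S)=\prod_{t\in S}j(\gamma,t)\in k^*$. One has $J(\mu\gamma,S)=\mu^nJ(\gamma,S)$ for $\mu\in k^*$, so for $n$ even the class of $J(\gamma,S)$ in $k^*/(k^* )^2$ depends only on the image of $\gamma$ in $\operatorname{PGL}_2(k)$. For $\gamma\in\operatorname{PGL}_2(k)$, $\epsilon(\gamma,S)=1$ if $J(\gamma,S)$ is a square in $k^*$, and $\epsilon(\gamma,S)=-1$ otherwise. An element $\gamma\in\operatorname{PGL}_2(k)$ is potentially homothetic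 if it is conjugate in $\operatorname{PGL}_2(k)$ to the class of a matrix $\begin{pmatrix}0&1\\c&d\end{pmatrix}\in\operatorname{GL}_2(k)$ whose eigenvalues lie in $k_2\setminus k$. *)

theory Defs
  imports "HOL-Analysis.Analysis" "HOL-Algebra.Algebraic_Closure_Type"
begin

section \<open>The groups \<open>GL\<^sub>2(k)\<close> and \<open>PGL\<^sub>2(k)\<close>\<close>

definition GL2 :: "('k::field^2^2) monoid" where
  "GL2 = \<lparr>carrier = {A. invertible A}, mult = (**), one = mat 1\<rparr>"

text \<open>In HOL-Analysis, \<open>mat c\<close> is the scalar matrix with \<open>c\<close> on the diagonal.\<close>

definition scalars2 :: "('k::field^2^2) set" where
  "scalars2 = {mat c | c. c \<noteq> 0}"

definition PGL2 :: "('k::field^2^2) set monoid" where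
  "PGL2 = GL2 Mod scalars2"

definition pgl_class :: "'k::field^2^2 \<Rightarrow> ('k^2^2) set" where
  "pgl_class A = scalars2 #>\<^bsub>GL2\<^esub> A"

text \<open>
  An element of \<open>PGL2\<close> is a coset. The constructions below that go through \<open>pgl_rep\<close>
  are shown further down not to depend on the representative
  (\<open>pgl_act_pgl_class\<close>, \<open>eps_pgl_class\<close>).
\<close>

definition pgl_rep :: "('k::field^2^2) set \<Rightarrow> 'k^2^2" where
  "pgl_rep \<gamma> = (SOME A. A \<in> \<gamma>)"

definition mat2 :: "'k \<Rightarrow> 'k \<Rightarrow> 'k \<Rightarrow> 'k \<Rightarrow> 'k::field^2^2" where
  "mat2 a b c d = vector [vector [a, b], vector [c, d]]"


section \<open>The projective line and the action on it\<close>

datatype 'a P1 = Pt 'a | Infty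

text \<open>Matrices have entries in \<open>k\<close>; the points are those of \<open>P\<^sup>1\<close> over the algebraic closure
  \<open>'k alg_closure\<close>, into which \<open>k\<close> is embedded by \<open>to_ac\<close>.\<close>

fun mobius :: "'k::field^2^2 \<Rightarrow> 'k alg_closure P1 \<Rightarrow> 'k alg_closure P1" where
  "mobius A (Pt t) =
     (if to_ac (A$2$1) * t + to_ac (A$2$2) = 0 then Infty
      else Pt ((to_ac (A$1$1) * t + to_ac (A$1$2)) / (to_ac (A$2$1) * t + to_ac (A$2$2))))"
| "mobius A Infty = (if A$2$1 = 0 then Infty else Pt (to_ac (A$1$1) / to_ac (A$2$1)))"

definition pgl_act :: "('k::field^2^2) set \<Rightarrow> 'k alg_closure P1 \<Rightarrow> 'k alg_closure P1" where
  "pgl_act \<gamma> = mobius (pgl_rep \<gamma>)"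

definition fixed_points :: "('k::field^2^2) set \<Rightarrow> 'k alg_closure P1 set" where
  "fixed_points \<gamma> = {t. pgl_act \<gamma> t = t}"

definition galois :: "('k::field alg_closure \<Rightarrow> 'k alg_closure) set" where
  "galois = {\<sigma>. bij \<sigma> \<and> (\<forall>x y. \<sigma> (x + y) = \<sigma> x + \<sigma> y) \<and> (\<forall>x y. \<sigma> (x * y) = \<sigma> x * \<sigma> y)
               \<and> (\<forall>c. \<sigma> (to_ac c) = to_ac c)}"

text \<open>\<open>map_P1\<close> applies a map to the affine coordinate and fixes \<open>Infty\<close>.\<close>

definition rational_set :: "nat \<Rightarrow> 'k::field alg_closure P1 set \<Rightarrow> bool" where
  "rational_set n S \<longleftrightarrow> finite S \<and> card S = n \<and> (\<forall>\<sigma>\<in>galois. map_P1 \<sigma> ` S = S)"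


section \<open>Local multipliers and the sign\<close>

fun multiplier :: "'k::field^2^2 \<Rightarrow> 'k alg_closure P1 \<Rightarrow> 'k alg_closure" where
  "multiplier A (Pt t) =
     (if to_ac (A$2$1) * t + to_ac (A$2$2) \<noteq> 0
      then to_ac (det A) * inverse (to_ac (A$2$1) * t + to_ac (A$2$2))
      else to_ac (A$2$1))"
| "multiplier A Infty =
     (if A$2$1 = 0 then to_ac (A$2$2) else - to_ac (det A) * inverse (to_ac (A$2$1)))"

definition J :: "'k::field^2^2 \<Rightarrow> 'k alg_closure P1 set \<Rightarrow> 'k alg_closure" where
  "J A S = (\<Prod>t\<in>S. multiplier A t)"

text \<open>\<open>J\<close> is computed in the algebraic closure; being a square in \<open>k\<^sup>*\<close> means being the image
  of such a square.\<close>

definition square_in_base :: "'k::field alg_closure \<Rightarrow> bool" where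
  "square_in_base z \<longleftrightarrow> (\<exists>x. x \<noteq> 0 \<and> z = to_ac (x\<^sup>2))"

definition eps :: "('k::field^2^2) set \<Rightarrow> 'k alg_closure P1 set \<Rightarrow> int" where
  "eps \<gamma> S = (if square_in_base (J (pgl_rep \<gamma>) S) then 1 else -1)"


section \<open>Potentially homothetic elements\<close>

text \<open>The field \<open>k\<^sub>2\<close>: the subfield of the algebraic closure of degree 2 over \<open>k\<close>, which
  exists and is unique when \<open>k\<close> is finite.\<close>

definition quadratic_ext :: "'k::{field,finite} alg_closure set" where
  "quadratic_ext = (THE K. subfield K (ring_of_type_algebra :: 'k alg_closure ring)
     \<and> range to_ac \<subseteq> K
     \<and> Embedded_Algebras.ring.dimension (ring_of_type_algebra :: 'k alg_closure ring)
         2 (range to_ac) K)"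

definition eigenvalues :: "'k::field^2^2 \<Rightarrow> 'k alg_closure set" where
  "eigenvalues A = {\<mu>. \<exists>v. v \<noteq> 0 \<and> map_matrix to_ac A *v v = \<mu> *s v}"

definition potentially_homothetic :: "('k::{field,finite}^2^2) set \<Rightarrow> bool" where
  "potentially_homothetic \<gamma> \<longleftrightarrow>
     (\<exists>c d. mat2 0 1 c d \<in> carrier GL2
        \<and> eigenvalues (mat2 0 1 c d) \<subseteq> quadratic_ext - range to_ac
        \<and> (\<exists>g\<in>carrier PGL2. \<gamma> = g \<otimes>\<^bsub>PGL2\<^esub> pgl_class (mat2 0 1 c d) \<otimes>\<^bsub>PGL2\<^esub> inv\<^bsub>PGL2\<^esub> g))"


section \<open>Well-definedness\<close>

lemma group_GL2: "group (GL2 :: ('k::field^2^2) monoid)"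
proof (rule groupI)
  fix x :: "'k^2^2" assume "x \<in> carrier GL2"
  then show "\<exists>y\<in>carrier GL2. y \<otimes>\<^bsub>GL2\<^esub> x = \<one>\<^bsub>GL2\<^esub>"
    by (auto simp: GL2_def invertible_def)
qed (auto simp: GL2_def invertible_mult matrix_mul_assoc invertible_def[of "mat 1"] intro!: exI[of _ "mat 1"])

lemma mat_mult_entry: "(mat c ** (A::'k::field^2^2)) $ i $ j = c * A $ i $ j"
  by (simp add: matrix_matrix_mult_def mat_def if_distrib[where f="\<lambda>x. x * _"] cong: if_cong)

lemma mult_mat_entry: "((A::'k::field^2^2) ** mat c) $ i $ j = c * A $ i $ j"
  by (simp add: matrix_matrix_mult_def mat_def if_distrib[where f="\<lambda>x. _ * x"] mult.commute cong: if_cong)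

lemma mat_commute: "mat c ** (A::'k::field^2^2) = A ** mat c"
  by (simp add: vec_eq_iff mat_mult_entry mult_mat_entry)

lemma mat_mat: "mat c ** (mat d::'k::field^2^2) = mat (c * d)"
  by (simp add: vec_eq_iff mat_mult_entry) (simp add: mat_def)

lemma normal_scalars2: "scalars2 \<lhd> (GL2 :: ('k::field^2^2) monoid)"
proof -
  interpret group "GL2 :: ('k^2^2) monoid" by (rule group_GL2)
  have inv: "invertible (mat c :: 'k^2^2)" if "c \<noteq> 0" for c
    unfolding invertible_def using that
    by (intro exI[of _ "mat (inverse c)"]) (simp add: mat_mat)
  have sub: "scalars2 \<subseteq> carrier (GL2 :: ('k^2^2) monoid)"
    by (auto simp: scalars2_def GL2_def inv)
  have sg: "subgroup scalars2 (GL2 :: ('k^2^2) monoid)"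
  proof (rule subgroupI)
    show "scalars2 \<subseteq> carrier (GL2 :: ('k^2^2) monoid)" by (rule sub)
    show "scalars2 \<noteq> ({} :: ('k^2^2) set)" by (auto simp: scalars2_def intro: exI[of _ 1])
  next
    fix a :: "'k^2^2" assume a: "a \<in> scalars2"
    then obtain c where c: "a = mat c" "c \<noteq> 0" by (auto simp: scalars2_def)
    have m: "mat (inverse c) \<in> carrier (GL2 :: ('k^2^2) monoid)" using c by (simp add: GL2_def inv)
    have "inv\<^bsub>GL2\<^esub> a = mat (inverse c)"
    proof (rule inv_equality[OF _ _ m])
      show "a \<in> carrier GL2" using a sub by blast
      show "mat (inverse c) \<otimes>\<^bsub>GL2\<^esub> a = \<one>\<^bsub>GL2\<^esub>" using c by (simp add: GL2_def mat_mat)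
    qed
    then show "inv\<^bsub>GL2\<^esub> a \<in> scalars2"
      using c by (auto simp: scalars2_def)
  next
    fix a b :: "'k^2^2" assume "a \<in> scalars2" "b \<in> scalars2"
    then show "a \<otimes>\<^bsub>GL2\<^esub> b \<in> scalars2" by (force simp: scalars2_def GL2_def mat_mat)
  qed
  show ?thesis
    unfolding normal_def normal_axioms_def
    using sg group_GL2
    by (auto simp: r_coset_def l_coset_def GL2_def scalars2_def mat_commute)
qed

lemma group_PGL2: "group (PGL2 :: ('k::field^2^2) set monoid)"
  unfolding PGL2_def by (rule normal.factorgroup_is_group[OF normal_scalars2])

lemma mem_pgl_class_iff: "B \<in> pgl_class A \<longleftrightarrow> (\<exists>c. c \<noteq> 0 \<and> B = mat c ** A)"
  by (auto simp: pgl_class_def r_coset_def scalars2_def GL2_def)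

lemma carrier_PGL2: "carrier PGL2 = pgl_class ` carrier GL2"
  by (auto simp: PGL2_def FactGroup_def RCOSETS_def pgl_class_def)

lemma pgl_rep_pgl_class: obtains c where "c \<noteq> 0" "pgl_rep (pgl_class A) = mat c ** A"
proof -
  have "A \<in> pgl_class A" unfolding mem_pgl_class_iff by (intro exI[of _ 1]) simp
  then have "pgl_rep (pgl_class A) \<in> pgl_class A" unfolding pgl_rep_def by (rule someI)
  then show ?thesis using that unfolding mem_pgl_class_iff by blast
qed

lemma mobius_scale: "c \<noteq> 0 \<Longrightarrow> mobius (mat c ** A) t = mobius A t"
proof (cases t)
  case (Pt x)
  assume c: "c \<noteq> 0"
  have "to_ac c * to_ac a * x + to_ac c * to_ac b = to_ac c * (to_ac a * x + to_ac b)" for a b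
    by (simp add: algebra_simps)
  then show ?thesis using c Pt by (simp add: mat_mult_entry)
qed (simp add: mat_mult_entry)

lemma pgl_act_pgl_class: "pgl_act (pgl_class A) = mobius A"
  unfolding pgl_act_def by (metis mobius_scale pgl_rep_pgl_class ext)

lemma multiplier_scale:
  assumes c: "c \<noteq> 0"
  shows "multiplier (mat c ** A) t = to_ac c * multiplier A t"
proof -
  have det: "det (mat c ** A) = c * c * det A"
    by (simp add: det_2 mat_mult_entry algebra_simps)
  show ?thesis
  proof (cases t)
    case (Pt x)
    have "to_ac c * to_ac a * x + to_ac c * to_ac b = to_ac c * (to_ac a * x + to_ac b)" for a b
      by (simp add: algebra_simps)
    then show ?thesis using c Pt det by (simp add: mat_mult_entry)
  qed (use c det in \<open>simp add: mat_mult_entry\<close>)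
qed

lemma J_scale: "c \<noteq> 0 \<Longrightarrow> J (mat c ** A) S = to_ac c ^ card S * J A S"
  by (simp add: J_def multiplier_scale prod.distrib)

lemma square_in_base_scale:
  assumes "c \<noteq> 0" "even n"
  shows "square_in_base (to_ac c ^ n * z) \<longleftrightarrow> square_in_base z"
proof -
  from \<open>even n\<close> obtain m where m: "n = 2 * m" by blast
  have e: "to_ac c ^ n = to_ac ((c ^ m)\<^sup>2)" by (simp add: m flip: power_mult add: mult.commute)
  show ?thesis
  proof
    assume "square_in_base z"
    then obtain x where "x \<noteq> 0" "z = to_ac (x\<^sup>2)" by (auto simp: square_in_base_def)
    then show "square_in_base (to_ac c ^ n * z)"
      unfolding square_in_base_def e using assms
      by (intro exI[of _ "c ^ m * x"]) (simp add: power_mult_distrib)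
  next
    assume "square_in_base (to_ac c ^ n * z)"
    then obtain x where x: "x \<noteq> 0" "to_ac ((c ^ m)\<^sup>2) * z = to_ac (x\<^sup>2)"
      by (auto simp: square_in_base_def e)
    then show "square_in_base z"
      unfolding square_in_base_def using assms
      by (intro exI[of _ "x / c ^ m"]) (simp add: power_divide field_simps)
  qed
qed

lemma eps_pgl_class:
  assumes "even (card S)"
  shows "eps (pgl_class A) S = (if square_in_base (J A S) then 1 else -1)"
proof -
  obtain c where "c \<noteq> 0" "pgl_rep (pgl_class A) = mat c ** A" by (rule pgl_rep_pgl_class)
  then show ?thesis using assms by (simp add: eps_def J_scale square_in_base_scale)
qed

end

theory Submission
  imports Defs
begin

text \<open>The key is that the local multiplier is a cocycle. Represent \<open>t\<close> by the vector \<open>(t, 1)\<close> and infinity by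
  \<open>(-1, 0)\<close>. Then \<open>A\<close> maps the representative of \<open>t\<close> to \<open>det(A) / j(A, t)\<close> times that of \<open>A t\<close>
  (\<open>multiplier_homogeneous\<close>), and hence \<open>j(A B, t) = j(A, B t) j(B, t)\<close> (\<open>multiplier_mult\<close>). If \<open>A\<^sup>m\<close> is the
  scalar \<open>\<nu>\<close>, the product of \<open>j(A, \<cdot>)\<close> along an orbit with \<open>m\<close> elements is therefore \<open>j(A\<^sup>m, t) = \<nu>\<close>.

  A potentially homothetic element is the class of a matrix \<open>A\<close> whose characteristic polynomial is
  irreducible over \<open>k\<close>. Let \<open>\<alpha>\<close> be an eigenvalue. The two eigenvalues are \<open>\<alpha>\<close> and \<open>\<alpha>\<^sup>q\<close>, with product
  \<open>det(A)\<close>; a power \<open>A\<^sup>j\<close> is scalar iff \<open>\<alpha>\<^sup>j\<close> lies in \<open>k\<close>, and otherwise it has the same fixed points as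
  \<open>A\<close>. So outside the two fixed points every orbit has exactly \<open>m\<close> elements, \<open>m\<close> divides \<open>q + 1\<close>, and with
  \<open>\<nu> = \<alpha>\<^sup>m\<close> the determinant is the power of \<open>\<nu>\<close> with exponent \<open>(q + 1) / m\<close> (\<open>elliptic_order\<close>). Frobenius
  exchanges the fixed points, so \<open>S\<close> contains both or neither. If neither, \<open>J(A, S)\<close> is the power of \<open>\<nu>\<close> with
  exponent \<open>n / m\<close>. If both, they contribute the factor \<open>det(A)\<close> and the exponent is
  \<open>(q + 1) / m + (n - 2) / m\<close>. It remains to see when such a power is a square in \<open>k\<close> (\<open>elliptic_sign\<close>). For even \<open>m\<close>,
  \<open>\<nu>\<close> is not a square, since otherwise \<open>\<alpha>\<close> would have order at most \<open>m / 2\<close> modulo \<open>k\<^sup>*\<close>; for odd \<open>m\<close>,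
  all exponents are even because \<open>n\<close>, \<open>n - 2\<close> and \<open>q + 1\<close> are.

  Homotheties and translations fix infinity, so their multipliers can be read off the matrix. For \<open>\<lambda>t\<close> with
  infinity in \<open>S\<close>, \<open>J(A, S)\<close> is \<open>\<lambda>\<close> times a square, and Euler's criterion compares this with the order \<open>m\<close>
  of \<open>\<lambda>\<close> in \<open>k\<^sup>*\<close> (\<open>homothety_sign\<close>).\<close>

section \<open>Finite fields inside their algebraic closure\<close>

lemma power_card_eq_same:
  fixes x :: "'k::{field,finite}"
  shows "x ^ CARD('k) = x"
proof (cases "x = 0")
  case False
  have "x ^ card (UNIV - {0 :: 'k}) * \<Prod>(UNIV - {0}) = (\<Prod>y\<in>UNIV - {0}. x * y)"
    by (simp add: prod.distrib)
  also have "\<dots> = \<Prod>(UNIV - {0})"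
    by (rule prod.reindex_bij_witness[of _ "\<lambda>y. y / x" "\<lambda>y. x * y"]) (use False in auto)
  finally have "x ^ (CARD('k) - 1) = 1"
    by (simp add: card_Diff_singleton)
  moreover have "CARD('k) = Suc (CARD('k) - 1)"
    by simp
  ultimately show ?thesis
    by (metis mult.right_neutral power_Suc)
qed simp

lemma power_card_minus_1:
  fixes x :: "'k::{field,finite}"
  assumes "x \<noteq> 0"
  shows "x ^ (CARD('k) - 1) = 1"
proof -
  have "x * x ^ (CARD('k) - 1) = x * 1"
    using power_card_eq_same[of x] by (simp flip: power_Suc)
  then show ?thesis
    using assms by simp
qed

text \<open>In a field with an even number \<open>q\<close> of elements, \<open>-1 = (-1)\<^sup>q = 1\<close>, so the characteristic is 2.\<close>

lemma odd_card_field: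
  assumes "odd CHAR('k::{field,finite})"
  shows "odd CARD('k)"
proof
  assume "even CARD('k)"
  then have "(-1 :: 'k) = 1"
    using power_card_eq_same[of "-1 :: 'k"] by simp
  then have "of_nat 2 = (0 :: 'k)"
    by (metis add.right_inverse of_nat_numeral one_add_one)
  then have "CHAR('k) dvd 2"
    by (simp only: of_nat_eq_0_iff_char_dvd)
  then have "CHAR('k) = 1"
    using assms by (metis dvd_refl prime_nat_iff two_is_prime_nat)
  then show False
    by simp
qed

text \<open>The elements of \<open>k\<close> are \<open>q\<close> roots of \<open>X\<^sup>q - X\<close>, a polynomial of degree \<open>q\<close>, so there are no others.\<close>

lemma power_card_eq_iff_in_range_to_ac:
  fixes z :: "'k::{field,finite} alg_closure"
  shows "z ^ CARD('k) = z \<longleftrightarrow> z \<in> range to_ac"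
proof
  let ?p = "Polynomial.monom 1 (CARD('k)) - Polynomial.monom 1 1 :: 'k alg_closure poly"
  have card2: "CARD('k) \<ge> 2"
    using card_mono[of UNIV "{0, 1 :: 'k}"] by simp
  have deg: "Polynomial.degree ?p \<le> CARD('k)"
    by (intro degree_diff_le) (use card2 in \<open>auto simp: Polynomial.degree_monom_eq\<close>)
  have "Polynomial.coeff ?p (CARD('k)) = 1"
    using card2 by simp
  then have nz: "?p \<noteq> 0"
    by (metis coeff_0 zero_neq_one)
  have fin: "finite {x. poly ?p x = 0}"
    using nz by (rule poly_roots_finite)
  have sub: "range to_ac \<subseteq> {x. poly ?p x = 0}"
    by (auto simp: poly_monom simp flip: to_ac_power simp: power_card_eq_same)
  have "card (range (to_ac :: 'k \<Rightarrow> _)) = CARD('k)"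
    by (simp add: card_image inj_to_ac)
  moreover have "card {x. poly ?p x = 0} \<le> CARD('k)"
    using card_poly_roots_bound[OF nz] deg by linarith
  ultimately have eq: "range to_ac = {x. poly ?p x = 0}"
    using card_mono[OF fin sub] by (intro card_subset_eq[OF fin sub]) linarith
  assume "z ^ CARD('k) = z"
  then show "z \<in> range to_ac"
    unfolding eq by (simp add: poly_monom)
qed (auto simp: power_card_eq_same simp flip: to_ac_power)

lemma to_ac_power_card:
  fixes c :: "'k::{field,finite}"
  shows "to_ac c ^ CARD('k) = to_ac c"
  by (simp add: power_card_eq_same flip: to_ac_power)

text \<open>The difference \<open>(1 + X)\<^sup>q - 1 - X\<^sup>q\<close> has degree less than \<open>q\<close> and vanishes at all
  \<open>q\<close> elements of \<open>k\<close>, so it is the zero polynomial. This gives the additivity of Frobenius without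
  writing \<open>q\<close> as a power of the characteristic.\<close>

lemma power_card_add:
  fixes x y :: "'k::{field,finite} alg_closure"
  shows "(x + y) ^ CARD('k) = x ^ CARD('k) + y ^ CARD('k)"
proof (cases "x = 0")
  case False
  let ?p = "[:1, 1:] ^ CARD('k) - 1 - Polynomial.monom 1 (CARD('k)) :: 'k alg_closure poly"
  have "?p = 0"
  proof (rule ccontr)
    assume nz: "?p \<noteq> 0"
    have "Polynomial.degree ?p \<le> CARD('k)"
      by (intro degree_diff_le) (auto simp: degree_linear_power degree_monom_le)
    moreover have "Polynomial.coeff ?p (CARD('k)) = 0"
      by (simp add: coeff_linear_power)
    ultimately have deg: "Polynomial.degree ?p < CARD('k)"
      using nz by (metis leading_coeff_0_iff le_neq_implies_less)
    have "range to_ac \<subseteq> {x. poly ?p x = 0}"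
    proof clarify
      fix c :: 'k
      have "(1 + to_ac c) ^ CARD('k) = to_ac ((1 + c) ^ CARD('k))"
        by simp
      then show "poly ?p (to_ac c) = 0"
        unfolding power_card_eq_same
        by (simp add: poly_monom power_card_eq_same flip: to_ac_power)
    qed
    then have "card (range (to_ac :: 'k \<Rightarrow> _)) \<le> card {x. poly ?p x = 0}"
      by (intro card_mono poly_roots_finite nz)
    also have "\<dots> < CARD('k)"
      using card_poly_roots_bound[OF nz] deg by linarith
    finally show False
      by (simp add: card_image inj_to_ac)
  qed
  then have "poly ?p (y / x) = 0"
    by (metis poly_0)
  then have dream: "(1 + y / x) ^ CARD('k) = 1 + (y / x) ^ CARD('k)"
    by (simp add: poly_monom poly_power diff_diff_eq)
  have "x + y = x * (1 + y / x)"
    using False by (simp add: field_simps)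
  then have "(x + y) ^ CARD('k) = x ^ CARD('k) * (1 + (y / x) ^ CARD('k))"
    by (simp only: power_mult_distrib dream)
  then show ?thesis
    using False by (simp add: distrib_left power_divide)
qed (simp add: zero_power)

lemma frobenius_in_galois:
  "(\<lambda>z. z ^ CARD('k)) \<in> (galois :: ('k::{field,finite} alg_closure \<Rightarrow> _) set)"
proof -
  let ?F = "\<lambda>z :: 'k alg_closure. z ^ CARD('k)"
  have "inj ?F"
  proof (rule injI)
    fix x y :: "'k alg_closure"
    assume "x ^ CARD('k) = y ^ CARD('k)"
    moreover have "x ^ CARD('k) = (x - y) ^ CARD('k) + y ^ CARD('k)"
      using power_card_add[of "x - y" y] by simp
    ultimately show "x = y"
      by simp
  qed
  moreover have "surj ?F"
    using nth_root_exists[of "CARD('k)"] by (metis surjI zero_less_card_finite)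
  ultimately show ?thesis
    unfolding galois_def
    by (auto simp: bij_def power_card_add power_mult_distrib power_card_eq_same
             simp flip: to_ac_power)
qed

text \<open>Euler's criterion. For the direction from right to left, a square root \<open>z\<close> of \<open>l\<close> in the
  algebraic closure satisfies \<open>z\<^sup>q\<^sup>-\<^sup>1 = 1\<close>, which puts it in \<open>k\<close>.\<close>

lemma square_iff_power_half:
  fixes l :: "'k::{field,finite}"
  assumes "odd CARD('k)" "l \<noteq> 0"
  shows "(\<exists>x. l = x\<^sup>2) \<longleftrightarrow> l ^ ((CARD('k) - 1) div 2) = 1"
proof
  have half: "2 * ((CARD('k) - 1) div 2) = CARD('k) - 1"
    using assms(1) by simp
  show "l ^ ((CARD('k) - 1) div 2) = 1" if ex: "\<exists>x. l = x\<^sup>2"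
  proof -
    from ex obtain x where x: "l = x\<^sup>2"
      by blast
    then have "l ^ ((CARD('k) - 1) div 2) = x ^ (2 * ((CARD('k) - 1) div 2))"
      by (simp only: power_mult)
    then show ?thesis
      unfolding half using x assms(2) by (simp add: power_card_minus_1 del: One_nat_def)
  qed
  assume l: "l ^ ((CARD('k) - 1) div 2) = 1"
  obtain z where z: "z ^ 2 = to_ac l"
    using nth_root_exists[of 2 "to_ac l"] by auto
  have "z ^ (CARD('k) - 1) = (z ^ 2) ^ ((CARD('k) - 1) div 2)"
    unfolding power_mult[symmetric] half ..
  also have "\<dots> = 1"
    unfolding z using l by (simp flip: to_ac_power)
  finally have "z ^ (CARD('k) - 1) = 1" .
  then have "z ^ Suc (CARD('k) - 1) = z"
    by (simp only: power_Suc mult_1_right)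
  moreover have "Suc (CARD('k) - 1) = CARD('k)"
    by simp
  ultimately have "z ^ CARD('k) = z"
    by (simp only:)
  then obtain x where "z = to_ac x"
    unfolding power_card_eq_iff_in_range_to_ac by blast
  then show "\<exists>x. l = x\<^sup>2"
    using z by (metis to_ac_eq_iff to_ac_power)
qed

section \<open>The multiplier as a cocycle\<close>

text \<open>Homogeneous coordinates \<open>(hX t, hY t)\<close> of a point. The representative \<open>(-1, 0)\<close> of the point at
  infinity is chosen for its sign: with it, \<open>j(A, t)\<close> is in all four cases of its definition the
  factor comparing \<open>A (hX t, hY t)\<close> with the representative of \<open>A t\<close> (see
  \<open>multiplier_homogeneous\<close>), whereas \<open>(1, 0)\<close> would leave stray signs at infinity and at the pole.\<close>

fun hX hY :: "'a::field P1 \<Rightarrow> 'a" where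
  "hX (Pt t) = t" | "hX Infty = -1"
| "hY (Pt t) = 1" | "hY Infty = 0"

lemma P1_eq_iff: "u = v \<longleftrightarrow> hX u * hY v = hX v * hY u"
  by (cases u; cases v) auto

lemma hX_hY_nonzero: "hX t \<noteq> 0 \<or> hY t \<noteq> 0"
  by (cases t) auto

lemma in_GL2_iff_det: "A \<in> carrier GL2 \<longleftrightarrow> det A \<noteq> 0"
  by (simp add: GL2_def invertible_det_nz)

lemma multiplier_nonzero:
  fixes A :: "'k::field^2^2"
  assumes "det A \<noteq> 0"
  shows "multiplier A t \<noteq> 0"
proof -
  have "A$2$1 \<noteq> 0 \<or> A$2$2 \<noteq> 0"
    using assms by (auto simp: det_2)
  then show ?thesis
    using assms by (cases t) auto
qed

text \<open>The matrix \<open>A\<close> maps the representative of \<open>t\<close> to \<open>det A / j(A, t)\<close> times the representative of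
  \<open>A t\<close>. The cocycle rule, the action law and the description of fixed points all follow from this.\<close>

lemma multiplier_homogeneous:
  fixes A :: "'k::field^2^2"
  assumes "det A \<noteq> 0"
  shows "multiplier A t * (to_ac (A$1$1) * hX t + to_ac (A$1$2) * hY t)
           = to_ac (det A) * hX (mobius A t)"
    and "multiplier A t * (to_ac (A$2$1) * hX t + to_ac (A$2$2) * hY t)
           = to_ac (det A) * hY (mobius A t)"
proof -
  have *: "to_ac (A$2$1) * (to_ac (A$1$1) * x + to_ac (A$1$2)) = - to_ac (det A)"
    if "to_ac (A$2$1) * x + to_ac (A$2$2) = 0" for x
  proof -
    have "to_ac (A$2$2) = - (to_ac (A$2$1) * x)"
      using that by (simp add: add_eq_0_iff)
    then show ?thesis
      by (simp add: det_2 algebra_simps)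
  qed
  show "multiplier A t * (to_ac (A$1$1) * hX t + to_ac (A$1$2) * hY t)
           = to_ac (det A) * hX (mobius A t)"
  proof (cases t)
    case (Pt x)
    then show ?thesis
      using *[of x] assms by (cases "to_ac (A$2$1) * x + to_ac (A$2$2) = 0") (simp_all add: divide_inverse mult_ac)
  next
    case Infty
    then show ?thesis
      using assms by (cases "A$2$1 = 0") (simp_all add: det_2 divide_inverse algebra_simps)
  qed
  show "multiplier A t * (to_ac (A$2$1) * hX t + to_ac (A$2$2) * hY t)
           = to_ac (det A) * hY (mobius A t)"
    using assms by (cases t) simp_all
qed

text \<open>Apply \<open>multiplier_homogeneous\<close> to \<open>B\<close> at \<open>t\<close>, to \<open>A\<close> at \<open>B t\<close>, and to \<open>A ** B\<close> at \<open>t\<close>. This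
  computes the image of the representative of \<open>t\<close> in two ways; comparing directions gives the action
  law, and then comparing lengths gives the cocycle rule.\<close>

lemma
  fixes A B :: "'k::field^2^2"
  assumes A: "det A \<noteq> 0" and B: "det B \<noteq> 0"
  shows mobius_mult: "mobius (A ** B) t = mobius A (mobius B t)"
    and multiplier_mult: "multiplier (A ** B) t = multiplier A (mobius B t) * multiplier B t"
proof -
  let ?m = "multiplier (A ** B) t" and ?m' = "multiplier A (mobius B t) * multiplier B t"
  let ?u = "mobius (A ** B) t" and ?v = "mobius A (mobius B t)"
  let ?x = "\<lambda>(C :: 'k^2^2) t. to_ac (C$1$1) * hX t + to_ac (C$1$2) * hY t"
  let ?y = "\<lambda>(C :: 'k^2^2) t. to_ac (C$2$1) * hX t + to_ac (C$2$2) * hY t"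
  let ?d = "to_ac (det A) * to_ac (det B)"
  have AB: "det (A ** B) \<noteq> 0"
    using A B by (simp add: det_mul)
  have m: "?m \<noteq> 0" and m': "?m' \<noteq> 0"
    using A B AB by (simp_all add: multiplier_nonzero)
  note hB = multiplier_homogeneous[OF B, of t]
  note hA = multiplier_homogeneous[OF A, of "mobius B t"]
  have xAB: "?x (A ** B) t = to_ac (A$1$1) * ?x B t + to_ac (A$1$2) * ?y B t"
    and yAB: "?y (A ** B) t = to_ac (A$2$1) * ?x B t + to_ac (A$2$2) * ?y B t"
    by (simp_all add: matrix_matrix_mult_def sum_2 algebra_simps)
  have "?m' * ?x (A ** B) t = multiplier A (mobius B t) *
      (to_ac (A$1$1) * (multiplier B t * ?x B t) + to_ac (A$1$2) * (multiplier B t * ?y B t))"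
    unfolding xAB by (simp only: algebra_simps)
  also have "\<dots> = to_ac (det B) * (multiplier A (mobius B t) * ?x A (mobius B t))"
    unfolding hB by (simp only: algebra_simps)
  finally have x': "?m' * ?x (A ** B) t = ?d * hX ?v"
    unfolding hA by (simp only: mult_ac)
  have "?m' * ?y (A ** B) t = multiplier A (mobius B t) *
      (to_ac (A$2$1) * (multiplier B t * ?x B t) + to_ac (A$2$2) * (multiplier B t * ?y B t))"
    unfolding yAB by (simp only: algebra_simps)
  also have "\<dots> = to_ac (det B) * (multiplier A (mobius B t) * ?y A (mobius B t))"
    unfolding hB by (simp only: algebra_simps)
  finally have y': "?m' * ?y (A ** B) t = ?d * hY ?v"
    unfolding hA by (simp only: mult_ac)
  have x: "?m * ?x (A ** B) t = ?d * hX ?u" and y: "?m * ?y (A ** B) t = ?d * hY ?u"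
    using multiplier_homogeneous[OF AB, of t] by (simp_all add: det_mul)
  have d: "?d \<noteq> 0"
    using A B by simp
  have "?d * (?m * hX ?v) = ?m * (?m' * ?x (A ** B) t)"
    unfolding x' by (simp only: mult_ac)
  also have "\<dots> = ?m' * (?m * ?x (A ** B) t)"
    by (simp only: mult_ac)
  also have "\<dots> = ?d * (?m' * hX ?u)"
    unfolding x by (simp only: mult_ac)
  finally have X: "?m * hX ?v = ?m' * hX ?u"
    using d by (metis mult_left_cancel)
  have "?d * (?m * hY ?v) = ?m * (?m' * ?y (A ** B) t)"
    unfolding y' by (simp only: mult_ac)
  also have "\<dots> = ?m' * (?m * ?y (A ** B) t)"
    by (simp only: mult_ac)
  also have "\<dots> = ?d * (?m' * hY ?u)"
    unfolding y by (simp only: mult_ac)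
  finally have Y: "?m * hY ?v = ?m' * hY ?u"
    using d by (metis mult_left_cancel)
  have "?m * (hX ?u * hY ?v) = hX ?u * (?m * hY ?v)"
    by (simp only: mult_ac)
  also have "\<dots> = (?m' * hX ?u) * hY ?u"
    unfolding Y by (simp only: mult_ac)
  also have "\<dots> = ?m * (hX ?v * hY ?u)"
    unfolding X[symmetric] by (simp only: mult_ac)
  finally have "hX ?u * hY ?v = hX ?v * hY ?u"
    using m by (metis mult_left_cancel)
  then show uv: "?u = ?v"
    by (simp only: P1_eq_iff)
  show "?m = ?m'"
    using X Y hX_hY_nonzero[of ?v] unfolding uv by (metis mult_right_cancel)
qed

lemma mobius_mat: "c \<noteq> 0 \<Longrightarrow> mobius (mat c) t = t"
  by (cases t) (auto simp: mat_def)

lemma multiplier_mat: "c \<noteq> 0 \<Longrightarrow> multiplier (mat c) t = to_ac c"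
  by (cases t) (auto simp: mat_def det_2)

text \<open>A point is fixed iff its representative is an eigenvector, that is, iff the cross product of the
  representative with its image is zero.\<close>

lemma mobius_fixed_iff:
  fixes A :: "'k::field^2^2"
  assumes "det A \<noteq> 0"
  shows "mobius A t = t \<longleftrightarrow>
    (to_ac (A$1$1) * hX t + to_ac (A$1$2) * hY t) * hY t
      = (to_ac (A$2$1) * hX t + to_ac (A$2$2) * hY t) * hX t"
proof -
  let ?x = "to_ac (A$1$1) * hX t + to_ac (A$1$2) * hY t"
  let ?y = "to_ac (A$2$1) * hX t + to_ac (A$2$2) * hY t"
  have "mobius A t = t \<longleftrightarrow> to_ac (det A) * (hX (mobius A t) * hY t)
      = to_ac (det A) * (hX t * hY (mobius A t))"
    using assms by (simp add: P1_eq_iff)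
  also have "\<dots> \<longleftrightarrow> (to_ac (det A) * hX (mobius A t)) * hY t = (to_ac (det A) * hY (mobius A t)) * hX t"
    by (simp only: mult_ac)
  also have "\<dots> \<longleftrightarrow> multiplier A t * (?x * hY t) = multiplier A t * (?y * hX t)"
    unfolding multiplier_homogeneous[OF assms, symmetric] by (simp only: mult_ac)
  finally show ?thesis
    using multiplier_nonzero[OF assms] by simp
qed

section \<open>Powers and orders in the projective linear group\<close>

lemma mult_GL2: "mult GL2 = (**)" and one_GL2: "one GL2 = mat 1"
  by (simp_all add: GL2_def)

lemma det_pow_nonzero:
  assumes "det A \<noteq> 0"
  shows "det (A [^]\<^bsub>GL2\<^esub> (j::nat)) \<noteq> 0"
  using assms group.is_monoid[OF group_GL2, THEN monoid.nat_pow_closed] by (metis in_GL2_iff_det)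

lemma
  assumes A: "det A \<noteq> 0"
  shows mobius_pow: "mobius (A [^]\<^bsub>GL2\<^esub> (j::nat)) t = (mobius A ^^ j) t"
    and multiplier_pow: "multiplier (A [^]\<^bsub>GL2\<^esub> j) t = (\<Prod>i<j. multiplier A ((mobius A ^^ i) t))"
proof (induction j arbitrary: t)
  case 0
  {
    case 1
    show ?case by (simp add: one_GL2 mobius_mat)
  next
    case 2
    show ?case by (simp add: one_GL2 multiplier_mat)
  }
next
  case (Suc j)
  {
    case 1
    show ?case
      using A det_pow_nonzero[OF A, of j] Suc(1)[of "mobius A t"]
      by (simp add: mult_GL2 mobius_mult funpow_swap1)
  next
    case 2
    show ?case
      using A det_pow_nonzero[OF A, of j] Suc(2)[of "mobius A t"]
      by (simp add: mult_GL2 multiplier_mult prod.lessThan_Suc_shift funpow_swap1 mult.commute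
               del: prod.lessThan_Suc)
  }
qed

lemma pgl_class_hom: "pgl_class \<in> hom GL2 PGL2"
  unfolding pgl_class_def[abs_def] PGL2_def by (rule normal.r_coset_hom_Mod[OF normal_scalars2])

lemma group_hom_pgl_class: "group_hom GL2 PGL2 pgl_class"
  unfolding group_hom_def group_hom_axioms_def
  by (simp add: group_GL2 group_PGL2 pgl_class_hom)

lemma ord_pgl_class_dvd_iff:
  assumes "det A \<noteq> 0"
  shows "group.ord PGL2 (pgl_class A) dvd j \<longleftrightarrow> A [^]\<^bsub>GL2\<^esub> j \<in> scalars2"
proof -
  interpret group_hom "GL2 :: ('a^2^2) monoid" PGL2 pgl_class
    by (rule group_hom_pgl_class)
  have A: "A \<in> carrier GL2"
    using assms by (simp add: in_GL2_iff_det)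
  then have "group.ord PGL2 (pgl_class A) dvd j \<longleftrightarrow> pgl_class A [^]\<^bsub>PGL2\<^esub> j = \<one>\<^bsub>PGL2\<^esub>"
    by (intro H.pow_eq_id[symmetric]) simp
  also have "pgl_class A [^]\<^bsub>PGL2\<^esub> j = pgl_class (A [^]\<^bsub>GL2\<^esub> j)"
    using A by (simp add: hom_nat_pow)
  also have "pgl_class (A [^]\<^bsub>GL2\<^esub> j) = \<one>\<^bsub>PGL2\<^esub> \<longleftrightarrow> A [^]\<^bsub>GL2\<^esub> j \<in> scalars2"
    unfolding pgl_class_def PGL2_def one_FactGroup
    using A normal_imp_subgroup[OF normal_scalars2]
    by (meson G.coset_join1 G.coset_join2 G.nat_pow_closed)
  finally show ?thesis .
qed

section \<open>Products over free orbits\<close>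

text \<open>A set on which all orbits of \<open>f\<close> have exactly \<open>m\<close> elements is a disjoint union of such orbits;
  the induction removes one orbit at a time.\<close>

lemma prod_over_free_orbits:
  assumes "finite T" "f ` T = T" "m > 0"
    and "\<And>t. t \<in> T \<Longrightarrow> (f ^^ m) t = t"
    and "\<And>t j. t \<in> T \<Longrightarrow> 0 < j \<Longrightarrow> j < m \<Longrightarrow> (f ^^ j) t \<noteq> t"
    and "\<And>t. t \<in> T \<Longrightarrow> (\<Prod>i<m. g ((f ^^ i) t)) = (c :: 'b::comm_monoid_mult)"
  shows "m dvd card T \<and> prod g T = c ^ (card T div m)"
  using assms
proof (induction T rule: finite_psubset_induct)
  case (psubset T)
  show ?case
  proof (cases "T = {}")
    case False
    then obtain t where t: "t \<in> T"
      by blast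
    \<comment> \<open>\<open>f\<close> permutes the finite set \<open>T\<close>, so the complement of the orbit of \<open>t\<close> is again stable.\<close>
    let ?h = "\<lambda>i. (f ^^ i) t"
    define orb where "orb = ?h ` {..<m}"
    have inj: "inj_on f T"
      using psubset.prems(1) psubset.hyps by (simp add: eq_card_imp_inj_on)
    have h_T: "?h i \<in> T" for i
      using t psubset.prems(1) by (induction i) auto
    have "?h i \<noteq> ?h j" if "i < j" "j < m" for i j
    proof -
      have "(f ^^ (j - i)) (?h i) = ?h j"
        using that by (metis funpow_add comp_apply le_add_diff_inverse2 less_imp_le)
      moreover have "0 < j - i" "j - i < m"
        using that by auto
      ultimately show ?thesis
        using psubset.prems(4)[OF h_T[of i], of "j - i"] by metis
    qed
    then have inj_h: "inj_on ?h {..<m}"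
      by (intro linorder_inj_onI) auto
    have f_orb: "f ` orb \<subseteq> orb"
    proof
      fix u assume "u \<in> f ` orb"
      then obtain i where i: "i < m" "u = ?h (Suc i)"
        by (auto simp: orb_def)
      show "u \<in> orb"
      proof (cases "Suc i = m")
        case True
        then have "u = ?h 0"
          using i psubset.prems(3)[OF t] by simp
        then show ?thesis
          using psubset.prems(2) unfolding orb_def by (intro image_eqI[of _ _ 0]) auto
      next
        case False
        then show ?thesis
          using i unfolding orb_def by (intro image_eqI[of _ _ "Suc i"]) auto
      qed
    qed
    have orb_T: "orb \<subseteq> T"
      using h_T by (auto simp: orb_def)
    have fin_orb: "finite orb"
      by (simp add: orb_def)
    have "f ` orb = orb"
      using f_orb fin_orb card_image[OF inj_on_subset[OF inj orb_T]] by (simp add: card_subset_eq)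
    then have stable: "f ` (T - orb) = T - orb"
      using inj_on_image_set_diff[OF inj, of T orb] orb_T psubset.prems(1) by auto
    have smaller: "T - orb \<subset> T"
      using t psubset.prems(2) by (auto simp: orb_def intro: image_eqI[of _ _ 0])
    have IH: "m dvd card (T - orb) \<and> prod g (T - orb) = c ^ (card (T - orb) div m)"
      using psubset.prems smaller
      by (intro psubset.IH[OF smaller] stable) auto
    have card_orb: "card orb = m"
      using card_image[OF inj_h] by (simp add: orb_def)
    have card: "card T = m + card (T - orb)"
      using card_Diff_subset[OF fin_orb orb_T] card_mono[OF psubset.hyps orb_T] card_orb by simp
    have "prod g orb = c"
      using psubset.prems(5)[OF t] prod.reindex[OF inj_h, of g] by (simp add: orb_def)
    then have "prod g T = c * prod g (T - orb)"
      using prod.subset_diff[OF orb_T psubset.hyps, of g] by (simp add: mult.commute)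
    then show ?thesis
      using IH card psubset.prems(2) by simp
  qed simp
qed

section \<open>Elliptic matrices and their eigenvalues\<close>

text \<open>The characteristic polynomial, of degree 2, is irreducible over \<open>k\<close>.\<close>

definition elliptic :: "'k::field^2^2 \<Rightarrow> bool" where
  "elliptic A \<longleftrightarrow> (\<forall>x. x\<^sup>2 - trace A * x + det A \<noteq> 0)"

text \<open>The eigenvalues of \<open>A\<close>, as roots of the characteristic polynomial; in this form powers of \<open>A\<close> and
  of an eigenvalue obey the same recursion (\<open>pow_in_span\<close>).\<close>

definition char_root :: "'k::field^2^2 \<Rightarrow> 'k alg_closure \<Rightarrow> bool" where
  "char_root A \<alpha> \<longleftrightarrow> \<alpha>\<^sup>2 = to_ac (trace A) * \<alpha> - to_ac (det A)"

lemma trace_2: "trace (A :: 'k::field^2^2) = A$1$1 + A$2$2"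
  by (simp add: trace_def sum_2)

lemma elliptic_det_nonzero: "elliptic A \<Longrightarrow> det A \<noteq> 0"
  unfolding elliptic_def by (metis add_0 diff_self mult_zero_right power_zero_numeral)

lemma elliptic_lower_left_nonzero:
  fixes A :: "'k::field^2^2"
  assumes "elliptic A"
  shows "A$2$1 \<noteq> 0"
proof
  assume "A$2$1 = 0"
  then have "(A$1$1)\<^sup>2 - trace A * A$1$1 + det A = 0"
    by (simp add: trace_2 det_2 power2_eq_square algebra_simps)
  then show False
    using assms unfolding elliptic_def by blast
qed

lemma char_root_exists: "\<exists>\<alpha>. char_root A \<alpha>"
proof -
  let ?p = "[:to_ac (det A), - to_ac (trace A), 1:]"
  obtain \<alpha> where "poly ?p \<alpha> = 0"
    using alg_closed_imp_poly_has_root[of ?p] by auto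
  then show ?thesis
    by (intro exI[of _ \<alpha>]) (simp add: char_root_def power2_eq_square algebra_simps add_eq_0_iff)
qed

lemma char_root_notin_base:
  assumes "elliptic A" "char_root A \<alpha>"
  shows "\<alpha> \<notin> range to_ac"
proof
  assume "\<alpha> \<in> range to_ac"
  then obtain x where "\<alpha> = to_ac x"
    by blast
  then have "to_ac (x\<^sup>2 - trace A * x + det A) = 0"
    using assms(2) by (simp add: char_root_def)
  then show False
    using assms(1) unfolding elliptic_def by (metis to_ac_eq_0_iff)
qed

text \<open>Frobenius fixes the coefficients of the characteristic polynomial, so it sends \<open>\<alpha>\<close> to a root. This
  root is different from \<open>\<alpha>\<close>, which is not in \<open>k\<close>, so the two roots have the trace as sum and the
  determinant as product.\<close>

lemma char_root_conjugate:
  fixes A :: "'k::{field,finite}^2^2"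
  assumes "elliptic A" "char_root A \<alpha>"
  shows "\<alpha> + \<alpha> ^ CARD('k) = to_ac (trace A)" "\<alpha> * \<alpha> ^ CARD('k) = to_ac (det A)"
    and "char_root A (\<alpha> ^ CARD('k))"
proof -
  let ?\<beta> = "\<alpha> ^ CARD('k)"
  have "(to_ac (trace A) * \<alpha>) ^ CARD('k) = (\<alpha>\<^sup>2 + to_ac (det A)) ^ CARD('k)"
    using assms(2) by (simp add: char_root_def)
  then have "to_ac (trace A) * ?\<beta> = (\<alpha>\<^sup>2) ^ CARD('k) + to_ac (det A)"
    unfolding power_card_add by (simp add: power_mult_distrib power_card_eq_same flip: to_ac_power)
  then show root: "char_root A ?\<beta>"
    unfolding char_root_def by (simp add: algebra_simps flip: power_mult)
  have "(?\<beta> - \<alpha>) * (\<alpha> + ?\<beta> - to_ac (trace A))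
      = (?\<beta>\<^sup>2 - to_ac (trace A) * ?\<beta>) - (\<alpha>\<^sup>2 - to_ac (trace A) * \<alpha>)"
    by (simp add: algebra_simps power2_eq_square)
  also have "\<dots> = 0"
    using root[unfolded char_root_def] assms(2)[unfolded char_root_def] by (simp only:) simp
  finally have "(?\<beta> - \<alpha>) * (\<alpha> + ?\<beta> - to_ac (trace A)) = 0" .
  moreover have "?\<beta> \<noteq> \<alpha>"
    using char_root_notin_base[OF assms] by (simp add: power_card_eq_iff_in_range_to_ac)
  ultimately show sum: "\<alpha> + ?\<beta> = to_ac (trace A)"
    by simp
  have "\<alpha>\<^sup>2 = (\<alpha> + ?\<beta>) * \<alpha> - to_ac (det A)"
    using assms(2) unfolding sum char_root_def .
  then show "\<alpha> * ?\<beta> = to_ac (det A)"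
    by (simp add: algebra_simps power2_eq_square)
qed

lemma char_root_unique:
  fixes A :: "'k::{field,finite}^2^2"
  assumes "elliptic A" "char_root A \<alpha>" "char_root A \<beta>"
  shows "\<beta> = \<alpha> \<or> \<beta> = \<alpha> ^ CARD('k)"
proof -
  have "(\<beta> - \<alpha>) * (\<beta> - \<alpha> ^ CARD('k)) = \<beta>\<^sup>2 - (\<alpha> + \<alpha> ^ CARD('k)) * \<beta> + \<alpha> * \<alpha> ^ CARD('k)"
    by (simp add: algebra_simps power2_eq_square)
  also have "\<dots> = 0"
    unfolding char_root_conjugate[OF assms(1,2)] using assms(3) by (simp add: char_root_def)
  finally show ?thesis
    by simp
qed

text \<open>By Cayley-Hamilton both \<open>A\<close> and its eigenvalues satisfy \<open>Z\<^sup>2 = tr(A) Z - det(A)\<close>, so a power of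
  either reduces to the same linear expression \<open>x + y Z\<close>.\<close>

lemma pow_in_span:
  assumes "det A \<noteq> 0"
  shows "\<exists>x y. A [^]\<^bsub>GL2\<^esub> (j::nat) = mat x + mat y ** A
           \<and> (\<forall>\<alpha>. char_root A \<alpha> \<longrightarrow> \<alpha> ^ j = to_ac x + to_ac y * \<alpha>)"
proof (induction j)
  case 0
  show ?case
    by (intro exI[of _ 1] exI[of _ 0]) (simp add: one_GL2 vec_eq_iff mat_mult_entry)
next
  case (Suc j)
  then obtain x y where xy: "A [^]\<^bsub>GL2\<^esub> j = mat x + mat y ** A"
      "\<And>\<alpha>. char_root A \<alpha> \<Longrightarrow> \<alpha> ^ j = to_ac x + to_ac y * \<alpha>"
    by blast
  let ?x = "- y * det A" and ?y = "x + y * trace A"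
  have "A [^]\<^bsub>GL2\<^esub> Suc j = mat ?x + mat ?y ** A"
    using xy(1)
    by (simp add: mult_GL2 vec_eq_iff forall_2 matrix_matrix_mult_def sum_2 mat_def
        trace_2 det_2 algebra_simps)
  moreover have "\<alpha> ^ Suc j = to_ac ?x + to_ac ?y * \<alpha>" if "char_root A \<alpha>" for \<alpha>
  proof -
    have "\<alpha> ^ Suc j = to_ac x * \<alpha> + to_ac y * \<alpha>\<^sup>2"
      using xy(2)[OF that] by (simp add: algebra_simps power2_eq_square)
    then show ?thesis
      using that unfolding char_root_def by (simp add: algebra_simps)
  qed
  ultimately show ?case
    by blast
qed

text \<open>All three claims follow from \<open>A\<^sup>j = x + y A\<close> and \<open>\<alpha>\<^sup>j = x + y \<alpha>\<close>. Since \<open>A\<close> is not scalar and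
  \<open>\<alpha>\<close> is not in \<open>k\<close>, being scalar and being in \<open>k\<close> both mean \<open>y = 0\<close>. If \<open>y \<noteq> 0\<close>, then \<open>x + y A\<close> has
  the same eigenvectors as \<open>A\<close>, hence the same fixed points.\<close>

lemma
  fixes A :: "'k::field^2^2" and j :: nat
  assumes "elliptic A" "char_root A \<alpha>"
  shows elliptic_scalar_pow_iff: "A [^]\<^bsub>GL2\<^esub> j \<in> scalars2 \<longleftrightarrow> \<alpha> ^ j \<in> range to_ac"
    and elliptic_scalar_pow_eigenvalue: "A [^]\<^bsub>GL2\<^esub> j = mat c \<Longrightarrow> \<alpha> ^ j = to_ac c"
    and elliptic_nonscalar_pow_fixed:
      "A [^]\<^bsub>GL2\<^esub> j \<notin> scalars2 \<Longrightarrow> (mobius A ^^ j) t = t \<Longrightarrow> mobius A t = t"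
proof -
  note det = elliptic_det_nonzero[OF assms(1)]
  obtain x y where xy: "A [^]\<^bsub>GL2\<^esub> j = mat x + mat y ** A" "\<alpha> ^ j = to_ac x + to_ac y * \<alpha>"
    using pow_in_span[OF det, of j] assms(2) by blast
  note detj = det_pow_nonzero[OF det, of j]
  have entries: "(A [^]\<^bsub>GL2\<^esub> j)$1$1 = x + y * A$1$1" "(A [^]\<^bsub>GL2\<^esub> j)$1$2 = y * A$1$2"
    "(A [^]\<^bsub>GL2\<^esub> j)$2$1 = y * A$2$1" "(A [^]\<^bsub>GL2\<^esub> j)$2$2 = x + y * A$2$2"
    unfolding xy(1) by (simp_all add: mat_mult_entry) (simp_all add: mat_def)
  have y0: "y = 0" if "A [^]\<^bsub>GL2\<^esub> j = mat c" for c
    using entries(3) elliptic_lower_left_nonzero[OF assms(1)] unfolding that by (simp add: mat_def)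
  have range: "\<alpha> ^ j \<in> range to_ac \<longleftrightarrow> y = 0"
  proof
    assume "\<alpha> ^ j \<in> range to_ac"
    then obtain z where z: "\<alpha> ^ j = to_ac z"
      by blast
    show "y = 0"
    proof (rule ccontr)
      assume "y \<noteq> 0"
      then have "\<alpha> = to_ac ((z - x) / y)"
        using z xy(2) by (simp add: field_simps)
      then show False
        using char_root_notin_base[OF assms] by blast
    qed
  qed (simp add: xy(2))
  have scalar: "A [^]\<^bsub>GL2\<^esub> j = mat x" if "y = 0"
    using xy(1) that by (simp add: vec_eq_iff mat_mult_entry)
  show 1: "A [^]\<^bsub>GL2\<^esub> j \<in> scalars2 \<longleftrightarrow> \<alpha> ^ j \<in> range to_ac"
  proof
    assume "\<alpha> ^ j \<in> range to_ac"
    then have eq: "A [^]\<^bsub>GL2\<^esub> j = mat x"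
      using range scalar by blast
    moreover have "x \<noteq> 0"
      using detj unfolding eq by (auto simp: det_2 mat_def)
    ultimately show "A [^]\<^bsub>GL2\<^esub> j \<in> scalars2"
      by (auto simp: scalars2_def)
  qed (use y0 range in \<open>auto simp: scalars2_def\<close>)
  show "\<alpha> ^ j = to_ac c" if c: "A [^]\<^bsub>GL2\<^esub> j = mat c"
  proof -
    have "x = c"
      using entries(1) y0[OF c] unfolding c by (simp add: mat_def)
    then show ?thesis
      using xy(2) y0[OF c] by simp
  qed
  show "mobius A t = t" if ns: "A [^]\<^bsub>GL2\<^esub> j \<notin> scalars2" and fixed: "(mobius A ^^ j) t = t"
  proof -
    have "y \<noteq> 0"
      using ns 1 range by blast
    moreover have "mobius (A [^]\<^bsub>GL2\<^esub> j) t = t"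
      using fixed by (simp add: mobius_pow[OF det])
    ultimately show ?thesis
      unfolding mobius_fixed_iff[OF detj] mobius_fixed_iff[OF det] entries
    proof -
      let ?l = "(to_ac (A$1$1) * hX t + to_ac (A$1$2) * hY t) * hY t"
      let ?r = "(to_ac (A$2$1) * hX t + to_ac (A$2$2) * hY t) * hX t"
      assume y: "y \<noteq> 0"
        and eq: "(to_ac (x + y * A$1$1) * hX t + to_ac (y * A$1$2) * hY t) * hY t
          = (to_ac (y * A$2$1) * hX t + to_ac (x + y * A$2$2) * hY t) * hX t"
      have "to_ac y * ?l = to_ac y * ?r"
        using eq by (simp add: algebra_simps)
      then show "?l = ?r"
        using y by simp
    qed
  qed
qed

text \<open>If \<open>(t, 1)\<close> is an eigenvector of \<open>A\<close>, the second coordinate of its image is the eigenvalue.\<close>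

lemma mobius_fixed_Pt_iff:
  assumes "elliptic A"
  shows "mobius A (Pt t) = Pt t \<longleftrightarrow> char_root A (to_ac (A$2$1) * t + to_ac (A$2$2))"
proof -
  let ?c = "to_ac (A$2$1)" and ?d = "to_ac (A$2$2)"
  have c: "?c \<noteq> 0"
    using elliptic_lower_left_nonzero[OF assms] by simp
  have "(?c * t + ?d)\<^sup>2 - (to_ac (trace A) * (?c * t + ?d) - to_ac (det A))
      = ?c * ((?c * t + ?d) * t - (to_ac (A$1$1) * t + to_ac (A$1$2)))"
    by (simp add: trace_2 det_2 power2_eq_square algebra_simps)
  then have "char_root A (?c * t + ?d) \<longleftrightarrow>
      ?c * ((?c * t + ?d) * t - (to_ac (A$1$1) * t + to_ac (A$1$2))) = 0"
    unfolding char_root_def by (metis eq_iff_diff_eq_0)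
  also have "\<dots> \<longleftrightarrow> mobius A (Pt t) = Pt t"
    using c by (auto simp only: mobius_fixed_iff[OF elliptic_det_nonzero[OF assms]] hX.simps hY.simps
        mult_1_right mult_eq_0_iff right_minus_eq)
  finally show ?thesis ..
qed

text \<open>Fixed points correspond to eigenvalues through \<open>mobius_fixed_Pt_iff\<close>, so they are a conjugate pair.
  The multiplier at the fixed point with eigenvalue \<open>\<alpha>\<close> is \<open>det(A) / \<alpha>\<close>, and the two eigenvalues have
  product \<open>det(A)\<close>.\<close>

lemma elliptic_fixed_points:
  fixes A :: "'k::{field,finite}^2^2"
  assumes "elliptic A" "mobius A (Pt t) = Pt t"
  shows "{u. mobius A u = u} = {Pt t, Pt (t ^ CARD('k))}"
    and "t ^ CARD('k) \<noteq> t"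
    and "multiplier A (Pt t) * multiplier A (Pt (t ^ CARD('k))) = to_ac (det A)"
proof -
  let ?c = "to_ac (A$2$1)" and ?d = "to_ac (A$2$2)"
  define \<alpha> where "\<alpha> = ?c * t + ?d"
  note det = elliptic_det_nonzero[OF assms(1)]
  have c: "?c \<noteq> 0"
    using elliptic_lower_left_nonzero[OF assms(1)] by simp
  have root: "char_root A \<alpha>"
    using assms mobius_fixed_Pt_iff unfolding \<alpha>_def by blast
  note conj = char_root_conjugate[OF assms(1) root]
  have conj_eq: "\<alpha> ^ CARD('k) = ?c * t ^ CARD('k) + ?d"
    unfolding \<alpha>_def power_card_add by (simp add: power_mult_distrib to_ac_power_card)
  show "t ^ CARD('k) \<noteq> t"
    using char_root_notin_base[OF assms(1) root] conj_eq
    unfolding power_card_eq_iff_in_range_to_ac[symmetric] by (auto simp: \<alpha>_def)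
  show "{u. mobius A u = u} = {Pt t, Pt (t ^ CARD('k))}"
  proof (intro equalityI subsetI)
    fix u assume "u \<in> {u. mobius A u = u}"
    then obtain v where v: "u = Pt v" "char_root A (?c * v + ?d)"
      using mobius_fixed_Pt_iff[OF assms(1)] c by (cases u) auto
    then have "?c * v + ?d = \<alpha> \<or> ?c * v + ?d = \<alpha> ^ CARD('k)"
      using char_root_unique[OF assms(1) root] by blast
    then have "v = t \<or> v = t ^ CARD('k)"
      using c unfolding conj_eq unfolding \<alpha>_def by (metis add_right_cancel mult_left_cancel)
    then show "u \<in> {Pt t, Pt (t ^ CARD('k))}"
      using v(1) by auto
  next
    fix u assume "u \<in> {Pt t, Pt (t ^ CARD('k))}"
    then show "u \<in> {u. mobius A u = u}"
      using assms(2) conj(3) unfolding conj_eq mobius_fixed_Pt_iff[OF assms(1), symmetric] by auto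
  qed
  have nz: "\<alpha> \<noteq> 0"
    using char_root_notin_base[OF assms(1) root] by (metis rangeI to_ac_0)
  then have "multiplier A (Pt t) = to_ac (det A) * inverse \<alpha>"
    unfolding \<alpha>_def by simp
  moreover have "multiplier A (Pt (t ^ CARD('k))) = to_ac (det A) * inverse (\<alpha> ^ CARD('k))"
    using power_not_zero[OF nz, of "CARD('k)"] unfolding conj_eq by simp
  ultimately have "multiplier A (Pt t) * multiplier A (Pt (t ^ CARD('k)))
      = to_ac (det A) * to_ac (det A) * inverse (\<alpha> * \<alpha> ^ CARD('k))"
    by (simp add: mult_ac)
  then show "multiplier A (Pt t) * multiplier A (Pt (t ^ CARD('k))) = to_ac (det A)"
    unfolding conj(2) using det by (simp add: mult.assoc)
qed

lemma elliptic_fixed_point_exists: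
  assumes "elliptic A"
  shows "\<exists>t. mobius A (Pt t) = Pt t"
proof -
  obtain \<alpha> where "char_root A \<alpha>"
    using char_root_exists by blast
  moreover have "to_ac (A$2$1) \<noteq> 0"
    using elliptic_lower_left_nonzero[OF assms] by simp
  ultimately have "mobius A (Pt ((\<alpha> - to_ac (A$2$2)) / to_ac (A$2$1)))
      = Pt ((\<alpha> - to_ac (A$2$2)) / to_ac (A$2$1))"
    unfolding mobius_fixed_Pt_iff[OF assms] by simp
  then show ?thesis ..
qed

lemma rational_set_frobenius:
  fixes S :: "'k::{field,finite} alg_closure P1 set"
  assumes "rational_set n S" "Pt t \<in> S"
  shows "Pt (t ^ CARD('k)) \<in> S"
proof -
  have "map_P1 (\<lambda>z. z ^ CARD('k)) ` S = S"
    using assms(1) frobenius_in_galois unfolding rational_set_def by blast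
  then show ?thesis
    using assms(2) by force
qed

text \<open>The two fixed points are exchanged by Frobenius, so a rational set contains both or neither.\<close>

lemma elliptic_fixed_points_disjoint:
  fixes A :: "'k::{field,finite}^2^2"
  assumes "elliptic A" "rational_set n S" "\<not> {u. mobius A u = u} \<subseteq> S"
  shows "{u. mobius A u = u} \<inter> S = {}"
proof (rule ccontr)
  assume "{u. mobius A u = u} \<inter> S \<noteq> {}"
  then obtain u where u: "u \<in> S" "mobius A u = u"
    by blast
  have "A$2$1 \<noteq> 0"
    using elliptic_lower_left_nonzero[OF assms(1)] .
  then obtain t where t: "u = Pt t"
    using u(2) by (cases u) auto
  have "{u. mobius A u = u} \<subseteq> S"
    using u rational_set_frobenius[OF assms(2)] elliptic_fixed_points(1)[OF assms(1)]
    unfolding t by auto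
  then show False
    using assms(3) by blast
qed

text \<open>Conjugation keeps trace and determinant, so it is enough that \<open>x\<^sup>2 - d x - c\<close>, the characteristic
  polynomial of the model matrix with rows \<open>(0, 1)\<close> and \<open>(c, d)\<close>, has no root in \<open>k\<close>. A root \<open>x\<close> would
  give the eigenvector \<open>(1, x)\<close> with an eigenvalue in \<open>k\<close>.\<close>

lemma potentially_homothetic_elliptic:
  fixes \<gamma> :: "('k::{field,finite}^2^2) set"
  assumes "potentially_homothetic \<gamma>"
  obtains A where "elliptic A" "\<gamma> = pgl_class A"
proof -
  interpret group_hom "GL2 :: ('k^2^2) monoid" PGL2 pgl_class
    by (rule group_hom_pgl_class)
  obtain c d g where M: "mat2 0 1 c d \<in> carrier GL2"
    and eig: "eigenvalues (mat2 0 1 c d) \<subseteq> quadratic_ext - range to_ac"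
    and g: "g \<in> carrier PGL2"
    and \<gamma>: "\<gamma> = g \<otimes>\<^bsub>PGL2\<^esub> pgl_class (mat2 0 1 c d) \<otimes>\<^bsub>PGL2\<^esub> inv\<^bsub>PGL2\<^esub> g"
    using assms unfolding potentially_homothetic_def by blast
  obtain G where G: "G \<in> carrier GL2" "g = pgl_class G"
    using g unfolding carrier_PGL2 by blast
  define M where "M = mat2 0 1 c d"
  define G' where "G' = inv\<^bsub>GL2\<^esub> G"
  have G': "G' \<in> carrier GL2" and inv: "G' ** G = mat 1"
    using G G.l_inv by (simp_all add: G'_def flip: mult_GL2 one_GL2)
  have "\<gamma> = pgl_class (G ** M ** G')"
    using M G G' unfolding \<gamma> M_def[symmetric] by (simp add: G'_def flip: mult_GL2)
  moreover have "elliptic (G ** M ** G')"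
  proof -
    have "trace (G ** M ** G') = trace (G' ** G ** M)"
      by (metis matrix_mul_assoc trace_mul_sym)
    then have tr: "trace (G ** M ** G') = d"
      unfolding inv by (simp add: M_def mat2_def trace_2)
    have "det G' * det G = 1"
      unfolding det_mul[symmetric] inv by simp
    moreover have "det M = - c"
      by (simp add: M_def mat2_def det_2)
    moreover have "det (G ** M ** G') = det M * (det G' * det G)"
      by (simp only: det_mul mult_ac)
    ultimately have dt: "det (G ** M ** G') = - c"
      by simp
    have "x\<^sup>2 - d * x - c \<noteq> 0" for x
    proof
      assume x: "x\<^sup>2 - d * x - c = 0"
      then have x2: "x * x = c + d * x"
        by (simp add: power2_eq_square algebra_simps)
      let ?v = "vector [1, to_ac x] :: 'k alg_closure ^ 2"
      have "?v \<noteq> 0"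
        by (metis vector_2(1) zero_index zero_neq_one)
      moreover have "map_matrix to_ac M *v ?v = to_ac x *s ?v"
        using x2 by (simp add: vec_eq_iff forall_2 matrix_vector_mult_def sum_2 map_matrix_def
            M_def mat2_def flip: to_ac_mult to_ac_add)
      ultimately have "to_ac x \<in> eigenvalues M"
        unfolding eigenvalues_def by blast
      then show False
        using eig unfolding M_def by blast
    qed
    then show ?thesis
      unfolding elliptic_def tr dt by simp
  qed
  ultimately show ?thesis
    using that by blast
qed

section \<open>The sign of elliptic elements\<close>

lemma square_in_base_power_iff:
  fixes \<nu> :: "'k::field"
  assumes "\<nu> \<noteq> 0" and "\<nexists>x. \<nu> = x\<^sup>2"
  shows "square_in_base (to_ac (\<nu> ^ e)) \<longleftrightarrow> even e"
proof
  assume "even e"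
  then obtain h where "e = 2 * h"
    by blast
  then show "square_in_base (to_ac (\<nu> ^ e))"
    unfolding square_in_base_def using assms(1)
    by (intro exI[of _ "\<nu> ^ h"]) (simp add: power_mult mult.commute)
next
  assume "square_in_base (to_ac (\<nu> ^ e))"
  then obtain x where x: "\<nu> ^ e = x\<^sup>2"
    unfolding square_in_base_def to_ac_eq_iff by blast
  show "even e"
  proof (rule ccontr)
    assume "odd e"
    then obtain h where h: "e = 2 * h + 1"
      using oddE by blast
    have "\<nu> = (x / \<nu> ^ h)\<^sup>2"
      using x assms(1) unfolding h by (simp add: power_divide power_mult power_add field_simps power2_eq_square)
    then show False
      using assms(2) by blast
  qed
qed

text \<open>Write \<open>\<alpha>\<close> for an eigenvalue. The order \<open>m\<close> of the class of \<open>A\<close> is the order of \<open>\<alpha>\<close> modulo \<open>k\<^sup>*\<close>. Now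
  \<open>\<alpha>\<^sup>q\<^sup>+\<^sup>1 = det(A)\<close> lies in \<open>k\<close>, so \<open>m\<close> divides \<open>q + 1\<close>, and with \<open>\<nu> = \<alpha>\<^sup>m\<close> the determinant is the
  power of \<open>\<nu>\<close> with exponent \<open>(q + 1) / m\<close>. If \<open>m = 2 h\<close> and \<open>\<nu> = x\<^sup>2\<close>, then \<open>\<alpha>\<^sup>h\<close> would be \<open>x\<close> or \<open>- x\<close>, in
  contradiction to the minimality of \<open>m\<close>.\<close>

lemma elliptic_order:
  fixes A :: "'k::{field,finite}^2^2"
  assumes "elliptic A"
  defines "m \<equiv> group.ord PGL2 (pgl_class A)"
  obtains \<nu> where "A [^]\<^bsub>GL2\<^esub> m = mat \<nu>" "\<nu> \<noteq> 0"
    and "m dvd CARD('k) + 1" "det A = \<nu> ^ ((CARD('k) + 1) div m)"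
    and "even m \<Longrightarrow> \<nexists>x. \<nu> = x\<^sup>2"
proof -
  note det = elliptic_det_nonzero[OF assms(1)]
  obtain \<alpha> where \<alpha>: "char_root A \<alpha>"
    using char_root_exists by blast
  note order = ord_pgl_class_dvd_iff[OF det, folded m_def, unfolded elliptic_scalar_pow_iff[OF assms(1) \<alpha>]]
  have norm: "\<alpha> ^ (CARD('k) + 1) = to_ac (det A)"
    using char_root_conjugate(2)[OF assms(1) \<alpha>] by simp
  then have dvd: "m dvd CARD('k) + 1"
    unfolding order by blast
  then have m_pos: "m > 0"
    by (intro Nat.gr0I) auto
  obtain \<nu> where \<nu>: "A [^]\<^bsub>GL2\<^esub> m = mat \<nu>" "\<nu> \<noteq> 0"
    using ord_pgl_class_dvd_iff[OF det, folded m_def, of m] unfolding scalars2_def by auto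
  have pow: "\<alpha> ^ m = to_ac \<nu>"
    by (rule elliptic_scalar_pow_eigenvalue[OF assms(1) \<alpha> \<nu>(1)])
  have "to_ac (det A) = (\<alpha> ^ m) ^ ((CARD('k) + 1) div m)"
    unfolding norm[symmetric] power_mult[symmetric] using dvd by simp
  then have "det A = \<nu> ^ ((CARD('k) + 1) div m)"
    unfolding pow to_ac_power[symmetric] to_ac_eq_iff .
  moreover have "\<nexists>x. \<nu> = x\<^sup>2" if even: "even m"
  proof
    assume "\<exists>x. \<nu> = x\<^sup>2"
    then obtain x where x: "\<nu> = x\<^sup>2"
      by blast
    obtain h where h: "m = 2 * h"
      using even by blast
    have "(\<alpha> ^ h)\<^sup>2 = (to_ac x)\<^sup>2"
      using pow unfolding h x by (simp add: power_mult mult.commute)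
    then have "\<alpha> ^ h = to_ac x \<or> \<alpha> ^ h = to_ac (- x)"
      unfolding power2_eq_iff by simp
    then have "m dvd h"
      unfolding order by blast
    then show False
      using h m_pos by (auto dest: dvd_imp_le)
  qed
  ultimately show ?thesis
    using that \<nu> dvd by blast
qed

text \<open>By the cocycle rule the product of the multipliers along an orbit is \<open>j(A\<^sup>m, t) = \<nu>\<close>. Away from the
  fixed points every orbit has exactly \<open>m\<close> elements, because the powers \<open>A\<^sup>j\<close> with \<open>0 < j < m\<close> are not
  scalar and have no fixed points other than those of \<open>A\<close>.\<close>

lemma J_elliptic_free:
  fixes A :: "'k::{field,finite}^2^2"
  assumes "elliptic A" and "finite T" "mobius A ` T = T" "{u. mobius A u = u} \<inter> T = {}"
    and "A [^]\<^bsub>GL2\<^esub> m = mat \<nu>" "\<nu> \<noteq> 0" "m > 0" "m = group.ord PGL2 (pgl_class A)"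
  shows "m dvd card T \<and> J A T = to_ac \<nu> ^ (card T div m)"
  unfolding J_def
proof (rule prod_over_free_orbits[OF assms(2,3,7)])
  note det = elliptic_det_nonzero[OF assms(1)]
  obtain \<alpha> where \<alpha>: "char_root A \<alpha>"
    using char_root_exists by blast
  show "(mobius A ^^ m) t = t" for t
    using mobius_pow[OF det, of m t] assms(5,6) by (simp add: mobius_mat)
  show "(\<Prod>i<m. multiplier A ((mobius A ^^ i) t)) = to_ac \<nu>" for t
    using multiplier_pow[OF det, of m t] assms(5,6) by (simp add: multiplier_mat)
  show "(mobius A ^^ j) t \<noteq> t" if "t \<in> T" "0 < j" "j < m" for t j
  proof -
    have "\<not> m dvd j"
      using that by (auto dest: dvd_imp_le)
    then have "A [^]\<^bsub>GL2\<^esub> j \<notin> scalars2"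
      unfolding assms(8) ord_pgl_class_dvd_iff[OF det] .
    then show ?thesis
      using elliptic_nonscalar_pow_fixed[OF assms(1) \<alpha>] assms(4) that(1) by blast
  qed
qed

text \<open>In both cases \<open>J(A, S)\<close> is a power of \<open>\<nu>\<close>; a contained pair of fixed points contributes \<open>det(A)\<close>, itself
  a power of \<open>\<nu>\<close>. For even \<open>m\<close> the element \<open>\<nu>\<close> is not a square and the parity of the exponent decides. For
  odd \<open>m\<close> the exponent is even, as a sum of quotients of even numbers by \<open>m\<close>.\<close>

lemma elliptic_sign:
  fixes A :: "'k::{field,finite}^2^2"
  assumes "odd CARD('k)" "elliptic A" "rational_set n S" "even n" "mobius A ` S = S"
    and "m = group.ord PGL2 (pgl_class A)"
  shows "{u. mobius A u = u} \<subseteq> S \<Longrightarrow> m dvd CARD('k) + 1 \<and> m dvd n - 2 \<and>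
      eps (pgl_class A) S = (-1) ^ ((CARD('k) + 1) div m) * (-1) ^ ((n - 2) div m)"
    and "\<not> {u. mobius A u = u} \<subseteq> S \<Longrightarrow> m dvd n \<and> eps (pgl_class A) S = (-1) ^ (n div m)"
proof -
  let ?F = "{u. mobius A u = u}"
  obtain \<nu> where \<nu>: "A [^]\<^bsub>GL2\<^esub> m = mat \<nu>" "\<nu> \<noteq> 0"
    and dvd: "m dvd CARD('k) + 1" and det: "det A = \<nu> ^ ((CARD('k) + 1) div m)"
    and nonsq: "even m \<Longrightarrow> \<nexists>x. \<nu> = x\<^sup>2"
    using elliptic_order[OF assms(2), folded assms(6)] by blast
  have m_pos: "m > 0"
    using dvd by (intro Nat.gr0I) auto
  have fin: "finite S" and card: "card S = n"
    using assms(3) by (auto simp: rational_set_def)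
  note free = J_elliptic_free[OF assms(2) _ _ _ \<nu> m_pos assms(6)]
  have sign: "eps (pgl_class A) S = (-1) ^ e"
    if J: "J A S = to_ac (\<nu> ^ e)" and even: "odd m \<Longrightarrow> even e" for e
  proof -
    have "square_in_base (to_ac (\<nu> ^ e)) \<longleftrightarrow> even e"
    proof (cases "even m")
      case False
      then obtain h where "e = 2 * h"
        using even by blast
      then show ?thesis
        unfolding square_in_base_def using \<nu>(2)
        by (auto intro!: exI[of _ "\<nu> ^ h"] simp: power_mult mult.commute)
    qed (use square_in_base_power_iff[OF \<nu>(2) nonsq] in blast)
    then show ?thesis
      using J assms(4) card by (simp add: eps_pgl_class)
  qed
  show "m dvd n \<and> eps (pgl_class A) S = (-1) ^ (n div m)" if "\<not> ?F \<subseteq> S"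
  proof -
    have "m dvd n \<and> J A S = to_ac (\<nu> ^ (n div m))"
      using free[OF fin assms(5) elliptic_fixed_points_disjoint[OF assms(2,3) that]]
      by (simp add: card)
    moreover have "odd m \<Longrightarrow> even (n div m)"
      using assms(4) calculation by (metis dvd_mult_div_cancel even_mult_iff)
    ultimately show ?thesis
      using sign by blast
  qed
  show "m dvd CARD('k) + 1 \<and> m dvd n - 2 \<and>
      eps (pgl_class A) S = (-1) ^ ((CARD('k) + 1) div m) * (-1) ^ ((n - 2) div m)" if sub: "?F \<subseteq> S"
  proof -
    obtain t where "mobius A (Pt t) = Pt t"
      using elliptic_fixed_point_exists[OF assms(2)] by blast
    note fixed = elliptic_fixed_points[OF assms(2) this]
    have finF: "finite ?F" and cardF: "card ?F = 2" and JF: "J A ?F = to_ac (det A)"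
      unfolding J_def fixed(1) using fixed(2,3) by auto
    have inj: "inj_on (mobius A) S"
      using assms(5) fin by (simp add: eq_card_imp_inj_on)
    have "mobius A ` ?F = ?F"
      by force
    then have stable: "mobius A ` (S - ?F) = S - ?F"
      using inj_on_image_set_diff[OF inj _ sub, of S] assms(5) by simp
    have card': "card (S - ?F) = n - 2"
      using card_Diff_subset[OF finF sub] card cardF by simp
    have "m dvd n - 2 \<and> J A (S - ?F) = to_ac (\<nu> ^ ((n - 2) div m))"
      using free[OF _ stable] fin by (simp add: card')
    moreover have "J A S = J A (S - ?F) * J A ?F"
      unfolding J_def by (rule prod.subset_diff[OF sub fin])
    ultimately have "m dvd n - 2" and
      J: "J A S = to_ac (\<nu> ^ ((CARD('k) + 1) div m + (n - 2) div m))"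
      by (simp_all add: JF det power_add)
    moreover have "even ((CARD('k) + 1) div m + (n - 2) div m)" if "odd m"
    proof -
      have "even (m * ((CARD('k) + 1) div m))" "even (m * ((n - 2) div m))"
        using assms(1,4) dvd \<open>m dvd n - 2\<close> by simp_all
      then show ?thesis
        using that by simp
    qed
    ultimately show ?thesis
      using dvd sign[OF J] unfolding power_add by blast
  qed
qed

section \<open>The sign of homotheties and translations\<close>

lemma diagonal_pow:
  fixes A :: "'k::field^2^2"
  assumes "A$1$2 = 0" "A$2$1 = 0"
  shows "(A [^]\<^bsub>GL2\<^esub> (j::nat))$1$1 = (A$1$1) ^ j \<and> (A [^]\<^bsub>GL2\<^esub> j)$2$2 = (A$2$2) ^ j
       \<and> (A [^]\<^bsub>GL2\<^esub> j)$1$2 = 0 \<and> (A [^]\<^bsub>GL2\<^esub> j)$2$1 = 0"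
  by (induction j) (use assms in \<open>simp_all add: one_GL2 mult_GL2 matrix_matrix_mult_def sum_2 mat_def mult.commute\<close>)

lemma homothety_order:
  fixes A :: "'k::field^2^2"
  assumes "A$1$2 = 0" "A$2$1 = 0" "A$1$1 = l * A$2$2" "det A \<noteq> 0"
  shows "group.ord PGL2 (pgl_class A) dvd j \<longleftrightarrow> l ^ j = 1"
proof -
  note entries = diagonal_pow[OF assms(1,2), of j]
  have d: "A$2$2 \<noteq> 0"
    using assms by (auto simp: det_2)
  have "A [^]\<^bsub>GL2\<^esub> j \<in> scalars2 \<longleftrightarrow> (A$1$1) ^ j = (A$2$2) ^ j"
  proof
    assume "A [^]\<^bsub>GL2\<^esub> j \<in> scalars2"
    then show "(A$1$1) ^ j = (A$2$2) ^ j"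
      using entries by (auto simp: scalars2_def mat_def)
  next
    assume eq: "(A$1$1) ^ j = (A$2$2) ^ j"
    have "A [^]\<^bsub>GL2\<^esub> j = mat ((A$2$2) ^ j)"
      using entries eq by (simp add: vec_eq_iff forall_2 mat_def)
    then show "A [^]\<^bsub>GL2\<^esub> j \<in> scalars2"
      using d by (auto simp: scalars2_def)
  qed
  then show ?thesis
    using d by (simp add: ord_pgl_class_dvd_iff[OF assms(4)] assms(3) power_mult_distrib)
qed

text \<open>The matrix is diagonal with entries \<open>l d\<close> and \<open>d\<close>. Every finite point has multiplier \<open>l d\<close> and the point
  at infinity has multiplier \<open>d\<close>. As \<open>n\<close> is even, \<open>J(A, S)\<close> is a square if \<open>S\<close> omits infinity, and is \<open>l\<close>
  times a square otherwise. In the second case Euler's criterion applies, \<open>m\<close> being the order of \<open>l\<close>.\<close>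

lemma homothety_sign:
  fixes A :: "'k::{field,finite}^2^2"
  assumes "odd CARD('k)" "det A \<noteq> 0" "finite S" "card S = n" "even n" "n > 0"
    and "mobius A Infty = Infty" "\<And>t. mobius A (Pt t) = Pt (to_ac l * t)"
    and "m = group.ord PGL2 (pgl_class A)"
  shows "Infty \<in> S \<Longrightarrow> m dvd CARD('k) - 1 \<and> eps (pgl_class A) S = (-1) ^ ((CARD('k) - 1) div m)"
    and "Infty \<notin> S \<Longrightarrow> eps (pgl_class A) S = 1"
proof -
  let ?d = "A$2$2"
  have c: "A$2$1 = 0"
    using assms(7) by (auto split: if_splits)
  then have d: "?d \<noteq> 0"
    using assms(2) by (auto simp: det_2)
  have b: "A$1$2 = 0"
    using assms(8)[of 0] c d by simp
  have "to_ac (A$1$1 / ?d) = to_ac l"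
    using assms(8)[of 1] b c d by simp
  then have a: "A$1$1 = l * ?d"
    using d unfolding to_ac_eq_iff by (simp add: field_simps)
  have l: "l \<noteq> 0"
    using assms(2) a b by (auto simp: det_2)
  have finite_mult: "multiplier A (Pt t) = to_ac (l * ?d)" for t
    using a b c d by (simp add: det_2)
  have mult: "multiplier A u = to_ac (l * ?d)" if "u \<noteq> Infty" for u
    using that finite_mult by (cases u) blast+
  have eps: "eps (pgl_class A) S = (if square_in_base (J A S) then 1 else -1)"
    using assms(4,5) by (intro eps_pgl_class) simp
  obtain h where h: "n = 2 * h" "h > 0"
    using assms(5,6) by auto
  show "eps (pgl_class A) S = 1" if "Infty \<notin> S"
  proof -
    have "J A S = (\<Prod>t\<in>S. to_ac (l * ?d))"
      unfolding J_def using that by (intro prod.cong refl mult) auto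
    then have "J A S = to_ac (((l * ?d) ^ h)\<^sup>2)"
      using assms(4) h by (simp add: mult.commute flip: power_mult)
    then have "square_in_base (J A S)"
      unfolding square_in_base_def using l d by (intro exI[of _ "(l * ?d) ^ h"]) simp
    then show ?thesis
      unfolding eps by simp
  qed
  show "m dvd CARD('k) - 1 \<and> eps (pgl_class A) S = (-1) ^ ((CARD('k) - 1) div m)"
    if "Infty \<in> S"
  proof -
    note order = homothety_order[OF b c a assms(2), folded assms(9)]
    have dvd: "m dvd CARD('k) - 1"
      unfolding order by (rule power_card_minus_1[OF l])
    have "J A S = multiplier A Infty * (\<Prod>t\<in>S - {Infty}. multiplier A t)"
      unfolding J_def by (rule prod.remove[OF assms(3) that])
    also have "(\<Prod>t\<in>S - {Infty}. multiplier A t) = (\<Prod>t\<in>S - {Infty}. to_ac (l * ?d))"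
      by (intro prod.cong refl mult) auto
    \<comment> \<open>The \<open>n - 1 = 2 h - 1\<close> finite points, with the exponent written to show its square part.\<close>
    also have "\<dots> = to_ac ((l * ?d) ^ (2 * (h - 1) + 1))"
      using that assms(3,4) h by (cases h) (simp_all add: card_Diff_singleton)
    finally have J: "J A S = to_ac (l * (l ^ (h - 1) * ?d ^ h)\<^sup>2)"
      using c h(2) by (cases h) (simp_all add: power_add power_mult_distrib power_mult power2_eq_square mult_ac)
    have "square_in_base (J A S) \<longleftrightarrow> (\<exists>x. l = x\<^sup>2)"
    proof
      let ?s = "l ^ (h - 1) * ?d ^ h"
      have s: "?s \<noteq> 0"
        using l d by simp
      assume "square_in_base (J A S)"
      then obtain x where "l * ?s\<^sup>2 = x\<^sup>2"
        unfolding square_in_base_def J to_ac_eq_iff by blast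
      then have "l = (x / ?s)\<^sup>2"
        unfolding power_divide using s by (simp add: eq_divide_eq del: power_mult_distrib)
      then show "\<exists>x. l = x\<^sup>2" ..
    next
      assume "\<exists>x. l = x\<^sup>2"
      then obtain x where x: "l = x\<^sup>2"
        by blast
      show "square_in_base (J A S)"
        unfolding square_in_base_def J to_ac_eq_iff using l d x
        by (intro exI[of _ "x * (l ^ (h - 1) * ?d ^ h)"]) (simp add: power_mult_distrib)
    qed
    also have "\<dots> \<longleftrightarrow> m dvd (CARD('k) - 1) div 2"
      unfolding order by (rule square_iff_power_half[OF assms(1) l])
    also have "\<dots> \<longleftrightarrow> even ((CARD('k) - 1) div m)"
    proof -
      obtain r where r: "CARD('k) - 1 = m * r"
        using dvd by blast
      have "CARD('k) > 1"
        using card_mono[of UNIV "{0, 1 :: 'k}"] by simp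
      then have m0: "m > 0"
        using r by (intro Nat.gr0I) auto
      obtain q where q: "CARD('k) - 1 = 2 * q"
        using assms(1) by (metis dvdE odd_two_times_div_two_nat dvd_triv_left)
      have "m dvd q \<longleftrightarrow> 2 * m dvd m * r"
        unfolding r[symmetric] q by simp
      also have "\<dots> \<longleftrightarrow> even r"
        using m0 by (simp add: mult.commute[of 2])
      finally have "m dvd q \<longleftrightarrow> even r" .
      moreover have "(CARD('k) - 1) div 2 = q"
        unfolding q by simp
      moreover have "(CARD('k) - 1) div m = r"
        unfolding r using m0 by simp
      ultimately show ?thesis
        by (simp only:)
    qed
    finally show ?thesis
      using dvd unfolding eps by simp
  qed
qed

text \<open>Every point has the same multiplier, so \<open>J(A, S)\<close> is an even power of it.\<close>

lemma translation_sign: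
  fixes A :: "'k::{field,finite}^2^2"
  assumes "det A \<noteq> 0" "even (card S)"
    and "mobius A Infty = Infty" "\<And>t. mobius A (Pt t) = Pt (t + 1)"
  shows "eps (pgl_class A) S = 1"
proof -
  let ?d = "A$2$2"
  have c: "A$2$1 = 0"
    using assms(3) by (auto split: if_splits)
  then have d: "?d \<noteq> 0"
    using assms(1) by (auto simp: det_2)
  have b: "A$1$2 = ?d"
    using assms(4)[of 0] c d by simp
  have "to_ac (A$1$1 + A$1$2) = to_ac (2 * ?d)"
    using assms(4)[of 1] c d by (simp add: field_simps)
  then have a: "A$1$1 = ?d"
    unfolding to_ac_eq_iff b by simp
  have "multiplier A u = to_ac ?d" for u
    using a c d by (cases u) (simp_all add: det_2)
  moreover obtain h where "card S = 2 * h"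
    using assms(2) by blast
  ultimately have "J A S = to_ac ((?d ^ h)\<^sup>2)"
    by (simp add: J_def mult.commute flip: power_mult)
  then have "square_in_base (J A S)"
    unfolding square_in_base_def using d by (intro exI[of _ "?d ^ h"]) simp
  then show ?thesis
    using assms(2) by (simp add: eps_pgl_class)
qed

section \<open>The sign in all cases\<close>

theorem theorem3p4:
  fixes S :: "'k::{field,finite} alg_closure P1 set"
    and \<gamma> :: "('k^2^2) set"
    and n m q :: nat
  assumes "odd CHAR('k)"
    and "q = CARD('k)"
    and "even n" and "n > 0"
    and "rational_set n S"
    and "\<gamma> \<in> carrier PGL2"
    and "pgl_act \<gamma> ` S = S"
    and "m = group.ord PGL2 \<gamma>"
  shows
    "((\<exists>l. l \<noteq> 0 \<and> pgl_act \<gamma> Infty = Infty \<and> (\<forall>t. pgl_act \<gamma> (Pt t) = Pt (to_ac l * t)))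
        \<longrightarrow> (Infty \<in> S \<longrightarrow> m dvd q - 1 \<and> eps \<gamma> S = (-1) ^ ((q - 1) div m))
          \<and> (Infty \<notin> S \<longrightarrow> eps \<gamma> S = 1))
     \<and> (pgl_act \<gamma> Infty = Infty \<and> (\<forall>t. pgl_act \<gamma> (Pt t) = Pt (t + 1))
        \<longrightarrow> eps \<gamma> S = 1)
     \<and> (potentially_homothetic \<gamma>
        \<longrightarrow> (fixed_points \<gamma> \<subseteq> S \<longrightarrow> m dvd q + 1 \<and> m dvd n - 2
               \<and> eps \<gamma> S = (-1) ^ ((q + 1) div m) * (-1) ^ ((n - 2) div m))
          \<and> (\<not> fixed_points \<gamma> \<subseteq> S \<longrightarrow> m dvd n \<and> eps \<gamma> S = (-1) ^ (n div m)))"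
proof -
  obtain A where A: "\<gamma> = pgl_class A" and det: "det A \<noteq> 0"
    using assms(6) by (auto simp: carrier_PGL2 in_GL2_iff_det)
  have odd: "odd CARD('k)"
    by (rule odd_card_field[OF assms(1)])
  have S: "finite S" "card S = n"
    using assms(5) by (auto simp: rational_set_def)
  show ?thesis
  proof (intro conjI)
    show "(\<exists>l. l \<noteq> 0 \<and> pgl_act \<gamma> Infty = Infty \<and> (\<forall>t. pgl_act \<gamma> (Pt t) = Pt (to_ac l * t)))
        \<longrightarrow> (Infty \<in> S \<longrightarrow> m dvd q - 1 \<and> eps \<gamma> S = (-1) ^ ((q - 1) div m))
          \<and> (Infty \<notin> S \<longrightarrow> eps \<gamma> S = 1)"
      using homothety_sign[OF odd det S assms(3,4)] assms(8)
      unfolding A pgl_act_pgl_class assms(2) by blast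
    show "pgl_act \<gamma> Infty = Infty \<and> (\<forall>t. pgl_act \<gamma> (Pt t) = Pt (t + 1)) \<longrightarrow> eps \<gamma> S = 1"
      using translation_sign[OF det] S(2) assms(3)
      unfolding A pgl_act_pgl_class by blast
    show "potentially_homothetic \<gamma>
        \<longrightarrow> (fixed_points \<gamma> \<subseteq> S \<longrightarrow> m dvd q + 1 \<and> m dvd n - 2
               \<and> eps \<gamma> S = (-1) ^ ((q + 1) div m) * (-1) ^ ((n - 2) div m))
          \<and> (\<not> fixed_points \<gamma> \<subseteq> S \<longrightarrow> m dvd n \<and> eps \<gamma> S = (-1) ^ (n div m))"
    proof
      assume "potentially_homothetic \<gamma>"
      then obtain B where B: "elliptic B" "\<gamma> = pgl_class B"
        by (rule potentially_homothetic_elliptic)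
      have "mobius B ` S = S" "m = group.ord PGL2 (pgl_class B)"
        using assms(7,8) unfolding B(2) pgl_act_pgl_class by auto
      note sign = elliptic_sign[OF odd B(1) assms(5,3) this]
      show "(fixed_points \<gamma> \<subseteq> S \<longrightarrow> m dvd q + 1 \<and> m dvd n - 2
               \<and> eps \<gamma> S = (-1) ^ ((q + 1) div m) * (-1) ^ ((n - 2) div m))
          \<and> (\<not> fixed_points \<gamma> \<subseteq> S \<longrightarrow> m dvd n \<and> eps \<gamma> S = (-1) ^ (n div m))"
        using sign unfolding fixed_points_def B(2) pgl_act_pgl_class assms(2) by blast
    qed
  qed
qed

end
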